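(* Let $L$ be a planar triangulation with $n_L\ge 4$ vertices, let $H$ be its planar conjugated triangulation with edges $e_1,\dots,e_{m_H}$, and orient every edge of $H$ in the direction in which it is traversed by a fixed Eulerian circuit of $H$. Let $R=(r_{ij})$ be the $m_H\times m_H$ $0$–$1$ matrix with $r_{ij}=1$ if and only if the head of $e_i$ equals the tail of $e_j$. Then $R$ is anti-symmetric: $r_{ij}r_{ji}=0$ for all $i,j$.
   Context: A planar triangulation is a maximal planar simple graph, embedded in the plane so that every face (including the unbounded one) is a triangle. The planar conjugated triangulation $H$ of $L$ is the plane graph whose vertices are the midpoints of the edges of $L$, and in which, for every face of $L$, including the unbounded one, the three midpoints of its boundary edges are joined pairwise by three curves drawn inside that face (the medial graph of $L$); every vertex of $H$ has degree $4$, so $H$ has an Eulerian circuit. $R$ is the adjacency matrix of the edges of the oriented graph $H$. *)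

theory Defs
  imports
    "HOL-Analysis.Analysis"
    "Graph_Theory.Euler"
    "Jordan_Normal_Form.Matrix"
begin

text \<open>
  A plane (multi)graph is given by a finite set \<open>V\<close> of points of the plane and a finite
  set \<open>E\<close> of edges, each edge being the point set of an arc that joins two points of \<open>V\<close>.
  Parallel edges are different point sets with the same ends; there are no loops.
  Since the interior of an edge avoids \<open>V\<close>, the set of ends of \<open>e\<close> is \<open>e \<inter> V\<close>.
\<close>

definition arc_between :: "complex set \<Rightarrow> complex \<Rightarrow> complex \<Rightarrow> bool" where
  "arc_between e x y \<longleftrightarrow>
     (\<exists>g. arc g \<and> path_image g = e \<and> pathstart g = x \<and> pathfinish g = y)"

definition ends :: "complex set \<Rightarrow> complex set \<Rightarrow> complex set" where
  "ends V e = e \<inter> V"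

definition plane_multigraph :: "complex set \<Rightarrow> complex set set \<Rightarrow> bool" where
  "plane_multigraph V E \<longleftrightarrow>
     finite V \<and> finite E \<and>
     (\<forall>e\<in>E. \<exists>x y. arc_between e x y \<and> ends V e = {x, y}) \<and>
     (\<forall>e\<in>E. \<forall>f\<in>E. e \<noteq> f \<longrightarrow> e \<inter> f \<subseteq> V)"

definition plane_graph :: "complex set \<Rightarrow> complex set set \<Rightarrow> bool" where
  "plane_graph V E \<longleftrightarrow> plane_multigraph V E \<and> inj_on (ends V) E"

definition faces :: "complex set \<Rightarrow> complex set set \<Rightarrow> complex set set" where
  "faces V E = components (- (V \<union> \<Union>E))"

definition boundary_edges :: "complex set set \<Rightarrow> complex set \<Rightarrow> complex set set" where
  "boundary_edges E F = {e \<in> E. e \<subseteq> frontier F}"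

definition triangular_face :: "complex set \<Rightarrow> complex set set \<Rightarrow> complex set \<Rightarrow> bool" where
  "triangular_face V E F \<longleftrightarrow>
     (\<exists>a\<in>V. \<exists>b\<in>V. \<exists>c\<in>V. a \<noteq> b \<and> b \<noteq> c \<and> c \<noteq> a \<and>
       (\<exists>e\<^sub>1\<in>E. \<exists>e\<^sub>2\<in>E. \<exists>e\<^sub>3\<in>E.
          ends V e\<^sub>1 = {a, b} \<and> ends V e\<^sub>2 = {b, c} \<and> ends V e\<^sub>3 = {c, a} \<and>
          frontier F = e\<^sub>1 \<union> e\<^sub>2 \<union> e\<^sub>3))"

text \<open>
  Abstract simple graphs have a vertex set \<open>V\<close> and a set \<open>A\<close> of two-element subsets of \<open>V\<close>.
\<close>

definition simple_graph :: "'a set \<Rightarrow> 'a set set \<Rightarrow> bool" where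
  "simple_graph V A \<longleftrightarrow> finite V \<and> (\<forall>s\<in>A. s \<subseteq> V \<and> card s = 2)"

definition planar :: "'a set \<Rightarrow> 'a set set \<Rightarrow> bool" where
  "planar V A \<longleftrightarrow>
     (\<exists>pos E. inj_on pos V \<and> plane_graph (pos ` V) E \<and>
        ends (pos ` V) ` E = (\<lambda>s. pos ` s) ` A)"

definition maximal_planar :: "'a set \<Rightarrow> 'a set set \<Rightarrow> bool" where
  "maximal_planar V A \<longleftrightarrow>
     simple_graph V A \<and> planar V A \<and>
     (\<forall>x\<in>V. \<forall>y\<in>V. x \<noteq> y \<and> {x, y} \<notin> A \<longrightarrow> \<not> planar V (insert {x, y} A))"

definition planar_triangulation :: "complex set \<Rightarrow> complex set set \<Rightarrow> bool" where
  "planar_triangulation V E \<longleftrightarrow>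
     plane_graph V E \<and> maximal_planar V (ends V ` E) \<and>
     (\<forall>F\<in>faces V E. triangular_face V E F)"

text \<open>
  The midpoint \<open>\<mu> e\<close> of a curved edge \<open>e\<close> is any chosen interior point of \<open>e\<close>. Two edges of the
  triangulation may a priori lie on two common faces; each of these faces then contributes
  its own curve, so the conjugated triangulation is introduced as a multigraph.
\<close>

definition curve_in_face ::
    "complex set \<Rightarrow> complex \<Rightarrow> complex \<Rightarrow> complex set \<Rightarrow> bool" where
  "curve_in_face F x y h \<longleftrightarrow> arc_between h x y \<and> h - {x, y} \<subseteq> F"

definition conjugated_triangulation ::
    "complex set \<Rightarrow> complex set set \<Rightarrow> complex set \<Rightarrow> complex set set \<Rightarrow> bool" where
  "conjugated_triangulation V E VH EH \<longleftrightarrow>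
     plane_multigraph VH EH \<and>
     (\<exists>\<mu>. (\<forall>e\<in>E. \<mu> e \<in> e - V) \<and> VH = \<mu> ` E \<and>
        (\<forall>F\<in>faces V E. \<forall>e\<in>boundary_edges E F. \<forall>f\<in>boundary_edges E F. e \<noteq> f \<longrightarrow>
           (\<exists>!h. h \<in> EH \<and> curve_in_face F (\<mu> e) (\<mu> f) h)) \<and>
        (\<forall>h\<in>EH. \<exists>F\<in>faces V E. \<exists>e\<in>boundary_edges E F. \<exists>f\<in>boundary_edges E F.
           e \<noteq> f \<and> curve_in_face F (\<mu> e) (\<mu> f) h))"

definition orientation_of ::
    "complex set \<Rightarrow> complex set set \<Rightarrow> (complex, complex set) pre_digraph \<Rightarrow> bool" where
  "orientation_of VH EH D \<longleftrightarrow>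
     verts D = VH \<and> arcs D = EH \<and> (\<forall>h\<in>EH. {tail D h, head D h} = ends VH h)"

text \<open>
  An Eulerian circuit of the undirected multigraph, given by its start \<open>u\<close> and its list \<open>p\<close> of
  successive edges, traverses every edge exactly once. The edges are oriented
  in the direction of traversal exactly when \<open>p\<close> is a closed directed Euler trail.
\<close>

definition oriented_by_eulerian_circuit ::
    "complex set \<Rightarrow> complex set set \<Rightarrow> (complex, complex set) pre_digraph \<Rightarrow>
       complex \<Rightarrow> complex set list \<Rightarrow> bool" where
  "oriented_by_eulerian_circuit VH EH D u p \<longleftrightarrow>
     orientation_of VH EH D \<and> pre_digraph.euler_trail D u p u"

definition edge_adjacency_mat ::
    "('v, 'e) pre_digraph \<Rightarrow> nat \<Rightarrow> (nat \<Rightarrow> 'e) \<Rightarrow> int mat" where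
  "edge_adjacency_mat D m e =
     mat m m (\<lambda>(i, j). if head D (e i) = tail D (e j) then 1 else 0)"

end

theory Submission
  imports Defs
begin

text \<open>
  If \<open>r\<^sub>i\<^sub>j r\<^sub>j\<^sub>i \<noteq> 0\<close>, then \<open>e\<^sub>i\<close> and \<open>e\<^sub>j\<close> are parallel edges of \<open>H\<close>, so two edges of \<open>L\<close> lie on two
  common faces \<open>F \<noteq> G\<close>. These two edges share an end and \<open>L\<close> is simple, hence \<open>F\<close> and \<open>G\<close> have the
  same bounding triangle. By the Jordan curve theorem \<open>F\<close> and \<open>G\<close> cover the complement of this
  triangle, so \<open>L\<close> has no vertices besides the three corners.
\<close>

lemma arc_between_sym: "arc_between e x y \<Longrightarrow> arc_between e y x"
  unfolding arc_between_def
  by (metis arc_reversepath path_image_reversepath pathfinish_reversepath pathstart_reversepath)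

lemma arc_between_neq: "arc_between e x y \<Longrightarrow> x \<noteq> y"
  unfolding arc_between_def using arc_distinct_ends by blast

lemma arc_between_mem: "arc_between e x y \<Longrightarrow> x \<in> e \<and> y \<in> e"
  unfolding arc_between_def by auto

lemma curve_in_face_sym: "curve_in_face F x y h \<Longrightarrow> curve_in_face F y x h"
  unfolding curve_in_face_def using arc_between_sym by (auto simp: insert_commute)

lemma plane_multigraph_edgeE:
  assumes "plane_multigraph V E" "e \<in> E"
  obtains x y where "arc_between e x y" "ends V e = {x, y}"
proof -
  have "\<forall>e\<in>E. \<exists>x y. arc_between e x y \<and> ends V e = {x, y}"
    using assms(1) unfolding plane_multigraph_def by (elim conjE)
  with assms(2) show ?thesis using that by blast
qed

lemma edge_arc_between:
  assumes "plane_multigraph V E" "e \<in> E" "ends V e = {x, y}"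
  shows "arc_between e x y"
proof -
  obtain x' y' where "arc_between e x' y'" "ends V e = {x', y'}"
    using plane_multigraph_edgeE[OF assms(1,2)] by metis
  with assms(3) show ?thesis
    by (metis arc_between_sym doubleton_eq_iff)
qed

text \<open>\<open>ends V e\<close> is a pair and already contains the two distinct points
  \<open>x\<close> and \<open>y\<close>. This is how the ends of a curve of \<open>H\<close> are
  read off from the two midpoints that it joins.\<close>

lemma ends_eq_of_arc_between:
  assumes "plane_multigraph V E" "e \<in> E" "arc_between e x y" "x \<in> V" "y \<in> V"
  shows "ends V e = {x, y}"
proof -
  obtain x' y' where "ends V e = {x', y'}"
    using plane_multigraph_edgeE[OF assms(1,2)] by metis
  moreover have "x \<in> ends V e" "y \<in> ends V e" "x \<noteq> y"
    using assms arc_between_neq arc_between_mem unfolding ends_def by blast+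
  ultimately show ?thesis by auto
qed

text \<open>Two arcs meeting only at \<open>b\<close> join to an arc, and the third side meets that
  arc only at \<open>a\<close> and \<open>c\<close>, so it closes it up. The boundary of a triangle
  thereby becomes a Jordan curve.\<close>

lemma simple_path_triangle:
  assumes "arc_between e a b" "arc_between f b c" "arc_between g c a"
    and "e \<inter> f \<subseteq> {b}" "f \<inter> g \<subseteq> {c}" "g \<inter> e \<subseteq> {a}"
  obtains \<gamma> where "simple_path \<gamma>" "pathfinish \<gamma> = pathstart \<gamma>" "path_image \<gamma> = e \<union> f \<union> g"
proof -
  obtain p where p: "arc p" "path_image p = e" "pathstart p = a" "pathfinish p = b"
    using assms(1) unfolding arc_between_def by blast
  obtain q where q: "arc q" "path_image q = f" "pathstart q = b" "pathfinish q = c"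
    using assms(2) unfolding arc_between_def by blast
  obtain r where r: "arc r" "path_image r = g" "pathstart r = c" "pathfinish r = a"
    using assms(3) unfolding arc_between_def by blast
  have im: "path_image (p +++ q) = e \<union> f"
    using p q by (simp add: path_image_join)
  have "arc (p +++ q)"
    using p q assms(4) by (intro arc_join) auto
  then have "simple_path ((p +++ q) +++ r)"
    using p q r im assms(5,6) by (intro simple_path_join_loop) auto
  then show ?thesis
    using p q r im by (intro that[of "(p +++ q) +++ r"]) (auto simp: path_image_join)
qed

text \<open>Distinct edges meet only in \<open>V\<close>, so an edge that has a point outside
  \<open>V\<close> and is covered by the three sides must be one of them. The corners are named so
  that \<open>e\<close> and \<open>f\<close> share \<open>b\<close>, which allows two faces
  containing both edges to be compared.\<close>

lemma triangular_face_two_edges: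
  assumes "plane_graph V E" "triangular_face V E F"
    and "e \<in> boundary_edges E F" "f \<in> boundary_edges E F" "e \<noteq> f"
    and "\<not> e \<subseteq> V" "\<not> f \<subseteq> V"
  obtains a b c g where "a \<noteq> b" "b \<noteq> c" "c \<noteq> a" "g \<in> E"
    "ends V e = {a, b}" "ends V f = {b, c}" "ends V g = {c, a}" "frontier F = e \<union> f \<union> g"
proof -
  obtain a b c e1 e2 e3 where t: "a \<noteq> b" "b \<noteq> c" "c \<noteq> a" "e1 \<in> E" "e2 \<in> E" "e3 \<in> E"
    "ends V e1 = {a, b}" "ends V e2 = {b, c}" "ends V e3 = {c, a}"
    "frontier F = e1 \<union> e2 \<union> e3"
    using assms(2) unfolding triangular_face_def by blast
  have *: "h \<in> {e1, e2, e3}" if "h \<in> boundary_edges E F" "\<not> h \<subseteq> V" for h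
  proof (rule ccontr)
    assume "h \<notin> {e1, e2, e3}"
    moreover have "\<forall>e\<in>E. \<forall>f\<in>E. e \<noteq> f \<longrightarrow> e \<inter> f \<subseteq> V"
      using assms(1) unfolding plane_graph_def plane_multigraph_def by blast
    ultimately have "h \<inter> e1 \<subseteq> V" "h \<inter> e2 \<subseteq> V" "h \<inter> e3 \<subseteq> V"
      using that t(4-6) unfolding boundary_edges_def by auto
    with that t(10) show False unfolding boundary_edges_def by blast
  qed
  \<comment> \<open>The six ordered pairs of distinct sides; in each case the corners are renamed
    and the remaining side becomes \<open>g\<close>.\<close>
  consider "e = e1" "f = e2" | "e = e2" "f = e1" | "e = e2" "f = e3" | "e = e3" "f = e2"
    | "e = e3" "f = e1" | "e = e1" "f = e3"
    using *[OF assms(3,6)] *[OF assms(4,7)] assms(5) by auto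
  then show ?thesis
  proof cases
    case 1 then show ?thesis using t by (intro that[of a b c e3]) auto
  next
    case 2 then show ?thesis using t by (intro that[of c b a e3]) auto
  next
    case 3 then show ?thesis using t by (intro that[of b c a e1]) auto
  next
    case 4 then show ?thesis using t by (intro that[of a c b e1]) auto
  next
    case 5 then show ?thesis using t by (intro that[of c a b e2]) auto
  next
    case 6 then show ?thesis using t by (intro that[of b a c e2]) auto
  qed
qed

text \<open>A connected set that meets \<open>X\<close> but misses its frontier lies inside
  \<open>X\<close>. Hence each of \<open>F\<close> and \<open>G\<close> contains one of the two
  Jordan components, and disjointness forces these to be different ones.\<close>

lemma Compl_subset_Un_of_frontier_eq_simple_closed_path:
  fixes \<gamma> :: "real \<Rightarrow> complex"
  assumes \<gamma>: "simple_path \<gamma>" "pathfinish \<gamma> = pathstart \<gamma>"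
    and F: "F \<noteq> {}" "F \<inter> path_image \<gamma> = {}" "frontier F = path_image \<gamma>"
    and G: "G \<noteq> {}" "G \<inter> path_image \<gamma> = {}" "frontier G = path_image \<gamma>"
    and "F \<inter> G = {}"
  shows "- path_image \<gamma> \<subseteq> F \<union> G"
proof -
  obtain I J where IJ: "Topological_Spaces.connected I" "Topological_Spaces.connected J" "I \<noteq> {}" "J \<noteq> {}" "I \<inter> J = {}"
    "I \<union> J = - path_image \<gamma>"
    using Jordan_curve[OF \<gamma>] by metis
  have *: "A \<subseteq> X" if "X \<inter> A \<noteq> {}" "frontier X = path_image \<gamma>" "Topological_Spaces.connected A"
      "A \<inter> path_image \<gamma> = {}"
    for A X :: "complex set"
    using connected_Int_frontier[of A X] that by blast
  have **: "I \<subseteq> X \<or> J \<subseteq> X"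
    if "X \<noteq> {}" "X \<inter> path_image \<gamma> = {}" "frontier X = path_image \<gamma>" for X
  proof -
    have "X \<inter> I \<noteq> {} \<or> X \<inter> J \<noteq> {}" using that IJ by blast
    then show ?thesis using *[of X] that(3) IJ by blast
  qed
  show ?thesis using **[OF F] **[OF G] IJ \<open>F \<inter> G = {}\<close> by blast
qed

lemma faces_sharing_two_edges_eq:
  assumes L: "planar_triangulation V E" "card V \<ge> 4"
    and FG: "F \<in> faces V E" "G \<in> faces V E"
    and e: "e \<in> boundary_edges E F" "e \<in> boundary_edges E G" "\<not> e \<subseteq> V"
    and f: "f \<in> boundary_edges E F" "f \<in> boundary_edges E G" "\<not> f \<subseteq> V"
    and "e \<noteq> f"
  shows "F = G"
proof (rule ccontr)
  assume "F \<noteq> G"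
  have pg: "plane_graph V E" and tri: "triangular_face V E F" "triangular_face V E G"
    using L FG unfolding planar_triangulation_def by auto
  then have pm: "plane_multigraph V E" and inj: "inj_on (ends V) E"
    unfolding plane_graph_def by auto
  obtain a b c g where abc: "a \<noteq> b" "b \<noteq> c" "c \<noteq> a" "g \<in> E"
    "ends V e = {a, b}" "ends V f = {b, c}" "ends V g = {c, a}" "frontier F = e \<union> f \<union> g"
    using triangular_face_two_edges[OF pg tri(1) e(1) f(1) \<open>e \<noteq> f\<close> e(3) f(3)] by metis
  obtain a' b' c' g' where abc': "a' \<noteq> b'" "b' \<noteq> c'" "c' \<noteq> a'" "g' \<in> E"
    "ends V e = {a', b'}" "ends V f = {b', c'}" "ends V g' = {c', a'}"
    "frontier G = e \<union> f \<union> g'"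
    using triangular_face_two_edges[OF pg tri(2) e(2) f(2) \<open>e \<noteq> f\<close> e(3) f(3)] by metis
  \<comment> \<open>\<open>b\<close> is the only common end of \<open>e\<close> and
    \<open>f\<close>, so in both triangles the third side joins the same two remaining corners;
    \<open>L\<close> being simple, it is the same edge.\<close>
  have "ends V g' = ends V g"
    using abc abc' by (auto simp: doubleton_eq_iff)
  then have "g' = g" using inj abc(4) abc'(4) by (auto dest: inj_onD)
  have E: "e \<in> E" "f \<in> E" using e f unfolding boundary_edges_def by auto
  have "g \<noteq> e" "g \<noteq> f" using abc by (auto simp: doubleton_eq_iff)
  then have "e \<inter> f \<subseteq> V" "f \<inter> g \<subseteq> V" "g \<inter> e \<subseteq> V"
    using pm E abc(4) \<open>e \<noteq> f\<close> unfolding plane_multigraph_def by metis+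
  \<comment> \<open>A common point of two sides is a vertex, hence an end of both, and two sides of
    the triangle share just one corner.\<close>
  then have "e \<inter> f \<subseteq> ends V e \<inter> ends V f" "f \<inter> g \<subseteq> ends V f \<inter> ends V g"
    "g \<inter> e \<subseteq> ends V g \<inter> ends V e"
    unfolding ends_def by auto
  then have int: "e \<inter> f \<subseteq> {b}" "f \<inter> g \<subseteq> {c}" "g \<inter> e \<subseteq> {a}"
    using abc by auto
  obtain \<gamma> where \<gamma>: "simple_path \<gamma>" "pathfinish \<gamma> = pathstart \<gamma>"
    "path_image \<gamma> = e \<union> f \<union> g"
    using simple_path_triangle[OF edge_arc_between[OF pm E(1) abc(5)]
        edge_arc_between[OF pm E(2) abc(6)] edge_arc_between[OF pm abc(4,7)] int] by metis
  have ne: "F \<noteq> {}" "G \<noteq> {}"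
    using FG in_components_nonempty unfolding faces_def by blast+
  have sub: "F \<subseteq> - (V \<union> \<Union>E)" "G \<subseteq> - (V \<union> \<Union>E)"
    using FG in_components_subset unfolding faces_def by blast+
  have disj: "F \<inter> G = {}"
    using FG \<open>F \<noteq> G\<close> components_nonoverlap unfolding faces_def by metis
  have im: "path_image \<gamma> \<subseteq> \<Union>E" using \<gamma>(3) E abc(4) by auto
  have "- path_image \<gamma> \<subseteq> F \<union> G"
    using abc(8) abc'(8) \<open>g' = g\<close> \<gamma>(3) ne sub im disj
    by (intro Compl_subset_Un_of_frontier_eq_simple_closed_path[OF \<gamma>(1,2)]) auto
  \<comment> \<open>Faces contain no vertices, so every vertex lies on the curve; an edge contains
    no vertices except its ends, which leaves only the three corners.\<close>
  then have "V \<subseteq> e \<union> f \<union> g" using sub \<gamma>(3) by blast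
  then have "V \<subseteq> ends V e \<union> ends V f \<union> ends V g" unfolding ends_def by auto
  then have "V \<subseteq> {a, b, c}" using abc by auto
  then have "card V \<le> card {a, b, c}" by (intro card_mono) auto
  also have "\<dots> \<le> 3" using abc by simp
  finally show False using L(2) by simp
qed

text \<open>The ends of a curve determine the two edges of \<open>L\<close> whose midpoints it
  joins, these edges determine the face, and a face contributes one curve per pair. So
  \<open>H\<close>, introduced as a multigraph, is simple.\<close>

lemma conjugated_triangulation_inj_on_ends:
  assumes L: "planar_triangulation V E" "card V \<ge> 4"
    and H: "conjugated_triangulation V E VH EH"
  shows "inj_on (ends VH) EH"
proof (rule inj_onI)
  fix h k assume hk: "h \<in> EH" "k \<in> EH" "ends VH h = ends VH k"
  obtain \<mu> where pm: "plane_multigraph VH EH"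
    and \<mu>: "\<forall>e\<in>E. \<mu> e \<in> e - V" "VH = \<mu> ` E"
    and ex1: "\<forall>F\<in>faces V E. \<forall>e\<in>boundary_edges E F. \<forall>f\<in>boundary_edges E F. e \<noteq> f \<longrightarrow>
           (\<exists>!h. h \<in> EH \<and> curve_in_face F (\<mu> e) (\<mu> f) h)"
    and ex: "\<forall>h\<in>EH. \<exists>F\<in>faces V E. \<exists>e\<in>boundary_edges E F. \<exists>f\<in>boundary_edges E F.
           e \<noteq> f \<and> curve_in_face F (\<mu> e) (\<mu> f) h"
    using H unfolding conjugated_triangulation_def by (elim conjE exE)
  have "plane_multigraph V E"
    using L unfolding planar_triangulation_def plane_graph_def by blast
  then have disj: "e \<inter> f \<subseteq> V" if "e \<in> E" "f \<in> E" "e \<noteq> f" for e f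
    using that unfolding plane_multigraph_def by metis
  \<comment> \<open>A midpoint shared by two edges would lie in their intersection, hence in
    \<open>V\<close>.\<close>
  have inj: "inj_on \<mu> E"
  proof (rule inj_onI, rule ccontr)
    fix e f assume "e \<in> E" "f \<in> E" "\<mu> e = \<mu> f" "e \<noteq> f"
    then have "\<mu> e \<in> e \<inter> f - V" using \<mu>(1) by (metis Diff_iff IntI)
    then show False using disj[OF \<open>e \<in> E\<close> \<open>f \<in> E\<close> \<open>e \<noteq> f\<close>] by blast
  qed
  have sub: "boundary_edges E F \<subseteq> E" for F unfolding boundary_edges_def by auto
  have ends: "ends VH l = {\<mu> e, \<mu> f}"
    if "l \<in> EH" "e \<in> E" "f \<in> E" "curve_in_face F (\<mu> e) (\<mu> f) l" for l e f F
    using that \<mu>(2) by (intro ends_eq_of_arc_between[OF pm]) (auto simp: curve_in_face_def)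
  obtain F e f where F: "F \<in> faces V E" "e \<in> boundary_edges E F" "f \<in> boundary_edges E F"
    "e \<noteq> f" "curve_in_face F (\<mu> e) (\<mu> f) h" using ex hk(1) by blast
  obtain G e' f' where G: "G \<in> faces V E" "e' \<in> boundary_edges E G" "f' \<in> boundary_edges E G"
    "e' \<noteq> f'" "curve_in_face G (\<mu> e') (\<mu> f') k" using ex hk(2) by blast
  have E: "e \<in> E" "f \<in> E" "e' \<in> E" "f' \<in> E" using F G sub by blast+
  have "{\<mu> e, \<mu> f} = {\<mu> e', \<mu> f'}"
    using ends[OF hk(1) E(1,2) F(5)] ends[OF hk(2) E(3,4) G(5)] hk(3) by simp
  then have eq: "e = e' \<and> f = f' \<or> e = f' \<and> f = e'"
    using inj E by (auto simp: doubleton_eq_iff dest: inj_onD)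
  then have "F = G"
    using F G E \<mu>(1) by (intro faces_sharing_two_edges_eq[OF L, of F G e f]) auto
  moreover have "curve_in_face G (\<mu> e) (\<mu> f) k"
    using eq G(5) curve_in_face_sym by blast
  ultimately show "h = k" using ex1 F hk by blast
qed

theorem theorem19:
  fixes V VH :: "complex set" and E EH :: "complex set set"
    and D :: "(complex, complex set) pre_digraph"
    and u :: complex and p :: "complex set list"
    and m :: nat and e :: "nat \<Rightarrow> complex set" and R :: "int mat"
  assumes "planar_triangulation V E"
    and "card V \<ge> 4"
    and "conjugated_triangulation V E VH EH"
    and "bij_betw e {..<m} EH"
    and "oriented_by_eulerian_circuit VH EH D u p"
    and "R = edge_adjacency_mat D m e"
  shows "\<forall>i<m. \<forall>j<m. R $$ (i, j) * R $$ (j, i) = 0"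
proof (intro allI impI, rule ccontr)
  fix i j assume ij: "i < m" "j < m" and "R $$ (i, j) * R $$ (j, i) \<noteq> 0"
  \<comment> \<open>Both entries must be 1, so each of the two edges starts where the other one
    ends.\<close>
  then have ht: "head D (e i) = tail D (e j)" "head D (e j) = tail D (e i)"
    using assms(6) unfolding edge_adjacency_mat_def by (auto split: if_splits)
  have E: "e i \<in> EH" "e j \<in> EH" using assms(4) ij by (auto simp: bij_betw_def)
  have or: "{tail D h, head D h} = ends VH h" if "h \<in> EH" for h
    using assms(5) that unfolding oriented_by_eulerian_circuit_def orientation_of_def by blast
  have "ends VH (e i) = ends VH (e j)"
    using or[OF E(1)] or[OF E(2)] ht by (simp add: insert_commute)
  then have "e i = e j"
    using conjugated_triangulation_inj_on_ends[OF assms(1-3)] E by (auto dest: inj_onD)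
  \<comment> \<open>Once the two edges coincide, head and tail agree and \<open>e i\<close> would be
    a loop, whereas an arc has distinct ends. The diagonal case \<open>i = j\<close> is covered as
    well.\<close>
  then have "ends VH (e i) = {head D (e i)}" using or[OF E(1)] ht by simp
  moreover have "plane_multigraph VH EH"
    using assms(3) unfolding conjugated_triangulation_def by (elim conjE)
  ultimately have "arc_between (e i) (head D (e i)) (head D (e i))"
    using edge_arc_between[of VH EH "e i"] E(1) by simp
  then show False using arc_between_neq by blast
qed

end
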